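(* Let $C \subseteq \mathbb{D}$ be an h-convex set and let $c \in C$. Then for every real $k \geqslant 1$, the set $\delta^h_{c,k}(C)$ is h-convex.
   Context: Let $\mathbb{D} = \{z \in \mathbb{C} : |z|<1\}$ be the Poincaré disk with the metric $2|dz|/(1-|z|^2)$ (curvature $-1$). The hyperbolic distance of $z \in \mathbb{D}$ from the origin is $d(z) = 2\tanh^{-1}|z|$. Hyperbolic geodesics are the intersections with $\mathbb{D}$ of Euclidean circles orthogonal to the unit circle (a circle $|z-a|=r$ is orthogonal to the unit circle iff $|a|^2 = 1+r^2$), together with Euclidean lines through the origin. For distinct $u,v\in\mathbb{D}$, $[u,v]$ denotes the unique hyperbolic geodesic segment joining $u$ and $v$. A set $C \subseteq \mathbb{D}$ is called hyperbolic convex (h-convex) if for every $u,v \in C$ the segment $[u,v]$ lies in $C$. For $c\in\mathbb{D}$ let $\tau_c(z) = \dfrac{z+c}{1+\bar{c}z}$, the hyperbolic isometry of $\mathbb{D}$ that maps $0$ to $c$ and has positive derivative at $0$. For $k>0$, the hyperbolic dilation about the origin with factor $k$ is the map $\delta^h_{0,k}:\mathbb{D}\to\mathbb{D}$, $\delta^h_{0,k}(re^{i\theta}) = \tanh(k\tanh^{-1} r)\,e^{i\theta}$ for $0\leqslant r<1$ (so that the hyperbolic distance from $0$ is multiplied by $k$ along each geodesic ray from $0$). The hyperbolic dilation about $c\in\mathbb{D}$ with factor $k$ is $\delta^h_{c,k} = \tau_c\circ\delta^h_{0,k}\circ\tau_c^{-1}$. *)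

theory Defs
  imports "HOL-Analysis.Analysis"
begin

abbreviation unit_disk :: "complex set" where
  "unit_disk \<equiv> ball 0 1"

definition h_geodesic :: "complex set \<Rightarrow> bool" where
  "h_geodesic L \<longleftrightarrow>
     (\<exists>a r. r > 0 \<and> (cmod a)\<^sup>2 = 1 + r\<^sup>2 \<and> L = sphere a r \<inter> unit_disk) \<or>
     (\<exists>w. w \<noteq> 0 \<and> L = range (\<lambda>t::real. t *\<^sub>R w) \<inter> unit_disk)"

text \<open>
  The segment joining distinct points is the trace of an injective path between them inside
  a geodesic. Two distinct points of the disk lie on exactly one geodesic, and this geodesic
  is homeomorphic to the real line, so exactly one such trace exists and the set below is
  that trace. For \<open>u = v\<close> there is no injective path and the set is empty.
\<close>
definition h_segment :: "complex \<Rightarrow> complex \<Rightarrow> complex set" where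
  "h_segment u v = \<Union> {path_image g | g. arc g \<and> pathstart g = u \<and> pathfinish g = v \<and>
     (\<exists>L. h_geodesic L \<and> path_image g \<subseteq> L)}"

definition h_convex :: "complex set \<Rightarrow> bool" where
  "h_convex C \<longleftrightarrow> C \<subseteq> unit_disk \<and>
     (\<forall>u\<in>C. \<forall>v\<in>C. u \<noteq> v \<longrightarrow> h_segment u v \<subseteq> C)"

definition h_translation :: "complex \<Rightarrow> complex \<Rightarrow> complex" where
  "h_translation c z = (z + c) / (1 + cnj c * z)"

text \<open>
  At the origin the choice of argument is immaterial, because the modulus is then
  \<open>tanh 0 = 0\<close>.
\<close>
definition h_dilation0 :: "real \<Rightarrow> complex \<Rightarrow> complex" where
  "h_dilation0 k z = rcis (tanh (k * artanh (cmod z))) (Arg z)"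

definition h_dilation :: "complex \<Rightarrow> real \<Rightarrow> complex \<Rightarrow> complex" where
  "h_dilation c k =
     h_translation c \<circ> h_dilation0 k \<circ> inv_into unit_disk (h_translation c)"

end

theory Submission
  imports Defs
begin

text \<open>
  The map \<open>z \<mapsto> 2z / (1 + |z|\<^sup>2)\<close> to the Klein model turns hyperbolic segments into
  Euclidean ones, so h-convexity becomes ordinary convexity there. Translations act on the Klein
  model projectively, which reduces the theorem to \<open>c = 0\<close>. The Klein map is itself the
  hyperbolic dilation about the origin with factor 2, so it commutes with \<open>h_dilation0 k\<close>.

  It remains to dilate a convex set \<open>K\<close> with \<open>0 \<in> K\<close>. The inverse dilation divides \<open>x\<close> by
  \<open>G |x|\<close>, where \<open>G s = s / tanh (artanh s / k)\<close>. For \<open>k \<ge> 1\<close> the function \<open>G\<close> is concave and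
  nonincreasing, hence \<open>x \<mapsto> G |x|\<close> is concave. So the inverse dilation sends a point of the
  segment between the images of \<open>u\<close> and \<open>v\<close> to \<open>\<alpha> u + \<beta> v\<close> with \<open>\<alpha>, \<beta> \<ge> 0\<close> and
  \<open>\<alpha> + \<beta> \<le> 1\<close>, that is, into the triangle with vertices \<open>0\<close>, \<open>u\<close>, \<open>v\<close>.
\<close>

subsection \<open>Concavity of the radial profile\<close>

lemma tanh_artanh_real:
  fixes x :: real
  assumes "\<bar>x\<bar> < 1"
  shows "tanh (artanh x) = x"
proof -
  have "(1 + x) / (1 - x) > 0"
    using assms by (auto simp: abs_less_iff)
  then have "exp (- (2 * artanh x)) = (1 - x) / (1 + x)"
    by (simp add: artanh_def exp_minus exp_ln)
  then have "tanh (artanh x) = (1 - (1 - x) / (1 + x)) / (1 + (1 - x) / (1 + x))"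
    by (simp add: tanh_real_altdef)
  also have "\<dots> = x"
    using assms by (simp add: abs_less_iff add_divide_eq_iff diff_divide_eq_iff)
  finally show ?thesis .
qed

lemma artanh_real_pos:
  fixes x :: real
  assumes "0 < x" "x < 1"
  shows "0 < artanh x"
  using assms tanh_artanh_real[of x] tanh_real_pos_iff[of "artanh x"] by simp

lemma artanh_real_mono:
  fixes x y :: real
  assumes "0 \<le> x" "x \<le> y" "y < 1"
  shows "artanh x \<le> artanh y"
  using assms tanh_artanh_real[of x] tanh_artanh_real[of y]
    tanh_real_le_iff[of "artanh x" "artanh y"] by simp

section \<open>Growth inequalities for hyperbolic functions\<close>

lemma mult_sinh_le_sinh_mult:
  fixes k e :: real
  assumes "k \<ge> 1" "e \<ge> 0"
  shows "k * sinh e \<le> sinh (k * e)"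
proof -
  have "sinh (k * 0) - k * sinh 0 \<le> sinh (k * e) - k * sinh e"
  proof (rule DERIV_nonneg_imp_nondecreasing[OF assms(2)])
    fix x :: real
    assume "0 \<le> x"
    have "((\<lambda>x. sinh (k * x) - k * sinh x) has_real_derivative k * (cosh (k * x) - cosh x)) (at x)"
      by (auto intro!: derivative_eq_intros simp: algebra_simps)
    moreover have "cosh x \<le> cosh (k * x)"
      using \<open>0 \<le> x\<close> assms(1) mult_right_mono[of 1 k x] by (subst cosh_real_nonneg_le_iff) auto
    ultimately show "\<exists>D. ((\<lambda>x. sinh (k * x) - k * sinh x) has_real_derivative D) (at x) \<and> 0 \<le> D"
      using assms(1) by (intro exI conjI) auto
  qed
  then show ?thesis by simp
qed

text \<open>This is tanh (k e) \<le> k tanh e with denominators cleared. The difference of the sides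
  vanishes at 0 and has derivative (k^2 - 1) sinh x sinh (k x).\<close>

lemma sinh_mult_cosh_le:
  fixes k e :: real
  assumes "k \<ge> 1" "e \<ge> 0"
  shows "sinh (k * e) * cosh e \<le> k * sinh e * cosh (k * e)"
proof -
  let ?F = "\<lambda>x. k * sinh x * cosh (k * x) - sinh (k * x) * cosh x"
  have "?F 0 \<le> ?F e"
  proof (rule DERIV_nonneg_imp_nondecreasing[OF assms(2)])
    fix x :: real
    assume "0 \<le> x"
    have "(?F has_real_derivative (k * k - 1) * (sinh x * sinh (k * x))) (at x)"
      by (auto intro!: derivative_eq_intros simp: algebra_simps)
    moreover have "0 \<le> sinh x * sinh (k * x)"
      using \<open>0 \<le> x\<close> assms(1) by simp
    moreover have "1 \<le> k * k"
      using assms(1) mult_mono[of 1 k 1 k] by simp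
    ultimately show "\<exists>D. (?F has_real_derivative D) (at x) \<and> 0 \<le> D"
      by (intro exI[of _ "(k * k - 1) * (sinh x * sinh (k * x))"] conjI) auto
  qed
  then show ?thesis by simp
qed

text \<open>
  The derivative of \<open>radial_ratio k\<close> below at the point \<open>tanh (k * e)\<close>.
\<close>
definition slope_profile :: "real \<Rightarrow> real \<Rightarrow> real" where
  "slope_profile k e = (sinh e * cosh e - sinh (k * e) * cosh (k * e) / k) / (sinh e)\<^sup>2"

text \<open>The products in the numerator are compared factor by factor: k sinh e \<le> sinh (k e)
  and cosh e \<le> cosh (k e).\<close>

lemma slope_profile_nonpos:
  assumes "k \<ge> 1" "e \<ge> 0"
  shows "slope_profile k e \<le> 0"
proof -
  have "cosh e \<le> cosh (k * e)"
    using assms mult_right_mono[of 1 k e] by (subst cosh_real_nonneg_le_iff) auto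
  then have "(k * sinh e) * cosh e \<le> sinh (k * e) * cosh (k * e)"
    using assms mult_sinh_le_sinh_mult[OF assms] by (intro mult_mono) auto
  then show ?thesis
    using assms(1) unfolding slope_profile_def
    by (intro divide_nonpos_nonneg) (auto simp: field_simps)
qed

text \<open>The derivative in \<open>e\<close> has the sign of \<open>S * c - k * s * C\<close>,
  which \<open>sinh_mult_cosh_le\<close> controls. Since artanh s / k grows with s, this yields the
  concavity of \<open>radial_ratio k\<close>.\<close>

lemma slope_profile_antimono:
  assumes "k \<ge> 1" "0 < x" "x \<le> y"
  shows "slope_profile k y \<le> slope_profile k x"
proof (rule DERIV_nonpos_imp_nonincreasing[OF assms(3)])
  fix e :: real
  assume "x \<le> e"
  then have e: "e > 0" using assms by simp
  define s where "s = sinh e"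
  define c where "c = cosh e"
  define S where "S = sinh (k * e)"
  define C where "C = cosh (k * e)"
  have s: "s > 0" and C: "C > 0" and k: "k > 0"
    using e assms(1) by (auto simp: s_def C_def)
  have c2: "c\<^sup>2 = 1 + s\<^sup>2" and C2: "C\<^sup>2 = 1 + S\<^sup>2"
    by (auto simp: s_def c_def S_def C_def cosh_square_eq)
  let ?D = "((c * c + s * s - (C * C + S * S)) * s\<^sup>2 - (s * c - S * C / k) * (2 * s * c)) / (s\<^sup>2 * s\<^sup>2)"
  have "(slope_profile k has_real_derivative ?D) (at e)"
    unfolding slope_profile_def [abs_def] using s k
    by (auto intro!: derivative_eq_intros
        simp: s_def c_def S_def C_def divide_simps power2_eq_square) (simp add: algebra_simps)
  moreover have "?D = 2 * s * C * (S * c - k * s * C) / (k * (s\<^sup>2 * s\<^sup>2))"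
  proof -
    have "k * ((c * c + s * s - (C * C + S * S)) * s\<^sup>2 - (s * c - S * C / k) * (2 * s * c))
        = k * (c\<^sup>2 + s\<^sup>2 - (C\<^sup>2 + S\<^sup>2)) * s\<^sup>2 - 2 * k * s\<^sup>2 * c\<^sup>2 + 2 * S * C * s * c"
      using k by (simp add: field_simps power2_eq_square)
    \<comment> \<open>Eliminating the squares of \<open>c\<close> and \<open>C\<close> cancels the
      terms in s^4; what remains contains 1 + S^2 = C^2.\<close>
    also have "\<dots> = 2 * s * C * (S * c) - 2 * k * s\<^sup>2 * C\<^sup>2"
      unfolding c2 C2 by (simp add: algebra_simps power2_eq_square)
    also have "\<dots> = 2 * s * C * (S * c - k * s * C)"
      by (simp add: algebra_simps power2_eq_square)
    finally show ?thesis
      using k s by (simp add: divide_simps mult.commute)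
  qed
  moreover have "S * c - k * s * C \<le> 0"
    using sinh_mult_cosh_le[OF assms(1), of e] e by (simp add: s_def c_def S_def C_def)
  ultimately show "\<exists>D. (slope_profile k has_real_derivative D) (at e) \<and> D \<le> 0"
    using s C k by (intro exI[of _ ?D] conjI) (auto intro!: divide_nonpos_nonneg mult_nonneg_nonpos)
qed

text \<open>
  The radius of the preimage of a point of modulus \<open>s > 0\<close> under \<open>h_dilation0 k\<close> is
  \<open>s / radial_ratio k s\<close>. At \<open>s = 0\<close>, division by zero gives \<open>0\<close> instead of the limit \<open>k\<close>.
\<close>
definition radial_ratio :: "real \<Rightarrow> real \<Rightarrow> real" where
  "radial_ratio k s = s / tanh (artanh s / k)"

text \<open>Under s = tanh (k e) the ratio is tanh (k e) / tanh e. The quotient rule and 1 - tanh^2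
  = 1 / cosh^2 produce the slope.\<close>

lemma radial_ratio_deriv:
  assumes "k \<ge> 1" "0 < s" "s < 1"
  shows "(radial_ratio k has_real_derivative slope_profile k (artanh s / k)) (at s)"
proof -
  define e where "e = artanh s / k"
  have k: "k > 0" using assms by simp
  have e: "e > 0"
    using artanh_real_pos assms k by (simp add: e_def)
  have s: "s = sinh (k * e) / cosh (k * e)"
    using tanh_artanh_real[of s] assms k by (simp add: e_def tanh_def)
  have C2: "(cosh (k * e))\<^sup>2 = 1 + (sinh (k * e))\<^sup>2" and c2: "(cosh e)\<^sup>2 = 1 + (sinh e)\<^sup>2"
    by (simp_all add: cosh_square_eq)
  have 1: "1 - s\<^sup>2 = 1 / (cosh (k * e))\<^sup>2"
    using C2 by (simp add: s divide_simps) (smt (verit) zero_le_power2)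
  have 2: "1 - (tanh e)\<^sup>2 = 1 / (cosh e)\<^sup>2"
    using c2 by (simp add: tanh_def divide_simps) (smt (verit) zero_le_power2)
  have "(radial_ratio k has_real_derivative
      (tanh e - s * ((1 - (tanh e)\<^sup>2) * (1 / (1 - s\<^sup>2) / k))) / (tanh e * tanh e)) (at s)"
    unfolding radial_ratio_def [abs_def] using assms k e
    by (auto intro!: derivative_eq_intros simp: e_def)
  also have "(tanh e - s * ((1 - (tanh e)\<^sup>2) * (1 / (1 - s\<^sup>2) / k))) / (tanh e * tanh e) =
      slope_profile k e"
    unfolding 1 2 slope_profile_def
    using e k by (simp add: s tanh_def field_simps power2_eq_square)
  finally show ?thesis by (simp add: e_def)
qed

lemma radial_ratio_pos:
  assumes "k \<ge> 1" "0 < s" "s < 1"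
  shows "radial_ratio k s > 0"
  using assms artanh_real_pos[of s] by (simp add: radial_ratio_def)

lemma radial_ratio_antimono:
  assumes "k \<ge> 1" "0 < x" "x \<le> y" "y < 1"
  shows "radial_ratio k y \<le> radial_ratio k x"
proof (rule DERIV_nonpos_imp_nonincreasing[OF assms(3)])
  fix z
  assume "x \<le> z" "z \<le> y"
  then have z: "0 < z" "z < 1" using assms by auto
  then have "slope_profile k (artanh z / k) \<le> 0"
    using assms(1) artanh_real_pos[of z] by (intro slope_profile_nonpos) auto
  then show "\<exists>D. (radial_ratio k has_real_derivative D) (at z) \<and> D \<le> 0"
    using radial_ratio_deriv[OF assms(1) z] by blast
qed

lemma radial_ratio_concave:
  assumes "k \<ge> 1"
  shows "concave_on {0<..<1} (radial_ratio k)"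
  unfolding concave_on_def
proof (rule convex_on_realI)
  show "((\<lambda>x. - radial_ratio k x) has_real_derivative - slope_profile k (artanh x / k)) (at x)"
    if "x \<in> {0<..<1}" for x
    using radial_ratio_deriv[OF assms] that by (auto intro!: derivative_eq_intros)
  show "- slope_profile k (artanh x / k) \<le> - slope_profile k (artanh y / k)"
    if "x \<in> {0<..<1}" "y \<in> {0<..<1}" "x \<le> y" for x y
    using that assms artanh_real_pos[of x] artanh_real_mono[of x y]
    by (auto intro!: slope_profile_antimono divide_right_mono)
qed auto

text \<open>A concave nonincreasing function of a convex norm is concave. The combination must be
  nonzero: at 0 the default value 0 stands in for the limit k, and the inequality can fail.\<close>

lemma radial_ratio_norm_concave:
  fixes x y :: "'a :: real_normed_vector"
  assumes k: "k \<ge> 1" and x: "norm x < 1" and y: "norm y < 1"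
    and ab: "a \<ge> 0" "b \<ge> 0" "a + b = 1" and nz: "a *\<^sub>R x + b *\<^sub>R y \<noteq> 0"
  shows "a * radial_ratio k (norm x) + b * radial_ratio k (norm y)
    \<le> radial_ratio k (norm (a *\<^sub>R x + b *\<^sub>R y))"
proof -
  \<comment> \<open>For a zero endpoint: its term drops out because
    \<open>radial_ratio k 0 = 0\<close>. The rest follows from positivity and then
    monotonicity.\<close>
  have scaled: "b * radial_ratio k (norm y) \<le> radial_ratio k (norm (b *\<^sub>R y))"
    if "0 \<le> b" "b \<le> 1" "b *\<^sub>R y \<noteq> 0" "norm y < 1" for b and y :: 'a
  proof -
    have "norm y > 0" "b > 0" using that by auto
    have "b * radial_ratio k (norm y) \<le> radial_ratio k (norm y)"
      using that \<open>norm y > 0\<close> radial_ratio_pos[OF k, of "norm y"]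
      by (intro mult_left_le_one_le) auto
    also have "\<dots> \<le> radial_ratio k (b * norm y)"
      using that \<open>norm y > 0\<close> \<open>b > 0\<close> by (intro radial_ratio_antimono k mult_left_le_one_le) auto
    finally show ?thesis using that by simp
  qed
  consider "x = 0" | "y = 0" | "x \<noteq> 0" "y \<noteq> 0" by blast
  then show ?thesis
  proof cases
    case 1
    then show ?thesis using scaled[of b y] ab y nz by (simp add: radial_ratio_def)
  next
    case 2
    then show ?thesis using scaled[of a x] ab x nz by (simp add: radial_ratio_def)
  next
    case 3
    have m: "a * norm x + b * norm y \<in> {0<..<1}"
      using convexD[of "{0<..<1::real}" "norm x" "norm y" a b] 3 x y ab by auto
    have "a * radial_ratio k (norm x) + b * radial_ratio k (norm y)
        \<le> radial_ratio k (a * norm x + b * norm y)"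
      using radial_ratio_concave[OF k] 3 x y ab by (auto simp: concave_on_iff)
    also have "\<dots> \<le> radial_ratio k (norm (a *\<^sub>R x + b *\<^sub>R y))"
      using m nz norm_triangle_ineq[of "a *\<^sub>R x" "b *\<^sub>R y"] ab
      by (intro radial_ratio_antimono k) auto
    finally show ?thesis .
  qed
qed

subsection \<open>Dilations of convex sets\<close>

text \<open>Real scaling replaces polar coordinates. At \<open>z = 0\<close> the division by zero is
  harmless, as the scaled vector is 0.\<close>

lemma h_dilation0_scaleR: "h_dilation0 k z = (tanh (k * artanh (cmod z)) / cmod z) *\<^sub>R z"
proof (cases "z = 0")
  case False
  have "h_dilation0 k z = tanh (k * artanh (cmod z)) *\<^sub>R sgn z"
    using False by (simp add: h_dilation0_def rcis_def cis_Arg scaleR_conv_of_real)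
  then show ?thesis by (simp add: sgn_div_norm divide_inverse)
qed (simp add: h_dilation0_def)

lemma norm_h_dilation0:
  assumes "cmod z < 1" "k \<ge> 0"
  shows "cmod (h_dilation0 k z) = tanh (k * artanh (cmod z))"
proof -
  have "0 \<le> artanh (cmod z)"
    using artanh_real_mono[of 0 "cmod z"] assms by simp
  then show ?thesis using assms by (simp add: h_dilation0_def)
qed

lemma h_dilation0_in_disk:
  assumes "z \<in> unit_disk" "k \<ge> 0"
  shows "h_dilation0 k z \<in> unit_disk"
  using assms norm_h_dilation0[of z k] by (simp add: tanh_real_lt_1)

text \<open>Dilating multiplies artanh |z|, so factors multiply. The choice \<open>l = 1 / k\<close>
  gives inverses, and \<open>l = 2\<close> gives commutation with the Klein map.\<close>

lemma h_dilation0_mult: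
  assumes "z \<in> unit_disk" "k \<ge> 0"
  shows "h_dilation0 l (h_dilation0 k z) = h_dilation0 (l * k) z"
proof (cases "z = 0 \<or> k = 0")
  case True
  then show ?thesis by (auto simp: h_dilation0_scaleR)
next
  case False
  then have "tanh (k * artanh (cmod z)) \<noteq> 0"
    using assms artanh_real_pos[of "cmod z"] by auto
  moreover have "cmod (h_dilation0 k z) = tanh (k * artanh (cmod z))"
    using norm_h_dilation0[of z k] assms by simp
  ultimately show ?thesis
    unfolding h_dilation0_scaleR[of l "h_dilation0 k z"]
    by (simp add: artanh_tanh_real h_dilation0_scaleR mult.assoc)
qed

lemma h_dilation0_1:
  assumes "z \<in> unit_disk"
  shows "h_dilation0 1 z = z"
  using assms by (cases "z = 0") (simp_all add: h_dilation0_scaleR tanh_artanh_real)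

lemma convex_h_dilation0:
  assumes K: "convex K" "K \<subseteq> unit_disk" "0 \<in> K" and k: "k \<ge> 1"
  shows "convex (h_dilation0 k ` K)"
proof (rule convexI, elim imageE)
  fix x y u v :: complex and a b :: real
  assume ab: "a \<ge> 0" "b \<ge> 0" "a + b = 1"
    and u: "u \<in> K" "x = h_dilation0 k u" and v: "v \<in> K" "y = h_dilation0 k v"
  define w where "w = a *\<^sub>R x + b *\<^sub>R y"
  \<comment> \<open>Also correct at \<open>z = 0\<close>, where both sides vanish despite the
    default value of the ratio.\<close>
  have inv: "h_dilation0 (1 / k) z = (1 / radial_ratio k (cmod z)) *\<^sub>R z" for z
    by (simp add: h_dilation0_scaleR radial_ratio_def)
  have x: "x \<in> unit_disk" and y: "y \<in> unit_disk"
    using u v K(2) k h_dilation0_in_disk[of u k] h_dilation0_in_disk[of v k] by auto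
  then have w: "w \<in> unit_disk"
    unfolding w_def using ab by (intro convexD[OF convex_ball])
  show "a *\<^sub>R x + b *\<^sub>R y \<in> h_dilation0 k ` K"
  \<comment> \<open>At \<open>w = 0\<close> the divisor \<open>q\<close> below would be 0; there
    \<open>0 \<in> K\<close> is itself a preimage.\<close>
  proof (cases "w = 0")
    case True
    then show ?thesis
      using K(3) by (auto simp: w_def h_dilation0_scaleR intro!: image_eqI[of _ _ 0])
  next
    case False
    define q where "q = radial_ratio k (cmod w)"
    \<comment> \<open>Since x and y are u and v scaled by the ratios at |x| and |y|, dividing a x +
      b y by \<open>q\<close> gives u and v these coefficients.\<close>
    define \<alpha> where "\<alpha> = a * radial_ratio k (cmod x) / q"
    define \<beta> where "\<beta> = b * radial_ratio k (cmod y) / q"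
    have q: "q > 0"
      using radial_ratio_pos[OF k, of "cmod w"] False w by (simp add: q_def)
    have nn: "radial_ratio k (cmod z) \<ge> 0" if "z \<in> unit_disk" for z
      using radial_ratio_pos[OF k, of "cmod z"] that
      by (cases "z = 0") (auto simp: radial_ratio_def)
    have nonneg: "\<alpha> \<ge> 0" "\<beta> \<ge> 0"
      using ab q nn x y by (auto simp: \<alpha>_def \<beta>_def simp del: mem_ball_0)
    have "\<alpha> + \<beta> \<le> 1"
      using radial_ratio_norm_concave[OF k _ _ ab, of x y] x y False q
      by (simp add: \<alpha>_def \<beta>_def q_def w_def add_divide_distrib[symmetric])
    have unscale: "radial_ratio k (cmod z) *\<^sub>R h_dilation0 (1 / k) z = z" if "z \<in> unit_disk" for z
      using radial_ratio_pos[OF k, of "cmod z"] that by (cases "z = 0") (auto simp: inv)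
    have u': "u = h_dilation0 (1 / k) x" and v': "v = h_dilation0 (1 / k) y"
      using u v K(2) k by (auto simp: h_dilation0_mult h_dilation0_1 subset_iff simp del: mem_ball_0)
    have "h_dilation0 (1 / k) w = (1 / q) *\<^sub>R (a *\<^sub>R x + b *\<^sub>R y)"
      by (simp add: inv q_def w_def)
    also have "\<dots> = (1 / q) *\<^sub>R (a *\<^sub>R radial_ratio k (cmod x) *\<^sub>R u + b *\<^sub>R radial_ratio k (cmod y) *\<^sub>R v)"
      unfolding u' v' unscale[OF x] unscale[OF y] ..
    \<comment> \<open>The leftover weight goes to the vertex 0, which lies in
      \<open>K\<close>.\<close>
    also have "\<dots> = \<alpha> *\<^sub>R u + \<beta> *\<^sub>R v + (1 - \<alpha> - \<beta>) *\<^sub>R 0"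
      by (simp add: \<alpha>_def \<beta>_def scaleR_add_right)
    also have "\<dots> \<in> K"
    proof -
      have "convex hull {u, v, 0} \<subseteq> K"
        using u v K by (intro hull_minimal) auto
      moreover have "\<alpha> *\<^sub>R u + \<beta> *\<^sub>R v + (1 - \<alpha> - \<beta>) *\<^sub>R 0 \<in> convex hull {u, v, 0}"
        unfolding convex_hull_3 using nonneg \<open>\<alpha> + \<beta> \<le> 1\<close>
        by (intro CollectI exI[of _ \<alpha>] exI[of _ \<beta>] exI[of _ "1 - \<alpha> - \<beta>"]) auto
      ultimately show ?thesis by blast
    qed
    finally have "h_dilation0 (1 / k) w \<in> K" .
    moreover have "h_dilation0 k (h_dilation0 (1 / k) w) = w"
      using w k by (simp add: h_dilation0_mult h_dilation0_1 del: mem_ball_0)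
    ultimately show ?thesis
      unfolding w_def by (metis image_eqI)
  qed
qed

subsection \<open>The Klein model\<close>

definition klein :: "complex \<Rightarrow> complex" where
  "klein z = (2 / (1 + (cmod z)\<^sup>2)) *\<^sub>R z"

text \<open>The radius is the root in [0, 1) of t r^2 - 2 r + t = 0 with t = |y|, rationalized so
  that it stays regular at t = 0.\<close>

definition klein_inv :: "complex \<Rightarrow> complex" where
  "klein_inv y = (1 / (1 + sqrt (1 - (cmod y)\<^sup>2))) *\<^sub>R y"

text \<open>The double-argument formula for tanh at artanh |z|.\<close>

lemma klein_eq_h_dilation0:
  assumes "z \<in> unit_disk"
  shows "klein z = h_dilation0 2 z"
proof -
  have "tanh (artanh (cmod z) + artanh (cmod z)) = 2 * cmod z / (1 + (cmod z)\<^sup>2)"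
    using assms by (subst tanh_add) (simp_all add: tanh_artanh_real power2_eq_square)
  then show ?thesis
    by (cases "z = 0") (simp_all add: klein_def h_dilation0_scaleR)
qed

lemma klein_in_disk: "z \<in> unit_disk \<Longrightarrow> klein z \<in> unit_disk"
  using h_dilation0_in_disk[of z 2] klein_eq_h_dilation0 by simp

lemma klein_inv_in_disk:
  assumes "y \<in> unit_disk"
  shows "klein_inv y \<in> unit_disk"
proof -
  define r where "r = sqrt (1 - (cmod y)\<^sup>2)"
  have r: "r \<ge> 0"
    using assms by (simp add: r_def power_le_one)
  then have "cmod (klein_inv y) = cmod y / (1 + r)"
    by (simp add: klein_inv_def r_def[symmetric])
  then show ?thesis
    using assms r by (simp add: divide_less_eq)
qed

lemma klein_klein_inv:
  assumes "y \<in> unit_disk"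
  shows "klein (klein_inv y) = y"
proof -
  define r where "r = sqrt (1 - (cmod y)\<^sup>2)"
  have r: "r \<ge> 0" "r\<^sup>2 = 1 - (cmod y)\<^sup>2"
    using assms by (auto simp: r_def power_le_one)
  have "(2 / (1 + (cmod y / (1 + r))\<^sup>2)) * (1 / (1 + r)) = 1"
  proof -
    \<comment> \<open>The factorization |y|^2 = (1 + r) (1 - r) collapses the Klein
      denominator.\<close>
    have "1 + (cmod y / (1 + r))\<^sup>2 = 2 / (1 + r)"
    proof -
      have "(cmod y)\<^sup>2 = (1 + r) * (1 - r)"
        using r by (simp add: power2_eq_square algebra_simps)
      then have "(cmod y / (1 + r))\<^sup>2 = (1 - r) / (1 + r)"
        using r by (simp add: power_divide power2_eq_square)
      then have "1 + (cmod y / (1 + r))\<^sup>2 = 1 + (1 - r) / (1 + r)" by simp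
      also have "\<dots> = 2 / (1 + r)" using r(1) by (simp add: divide_simps)
      finally show ?thesis .
    qed
    then show ?thesis using r by simp
  qed
  moreover have "cmod (klein_inv y) = cmod y / (1 + r)"
    using r by (simp add: klein_inv_def r_def[symmetric])
  then have "klein (klein_inv y) = (2 / (1 + (cmod y / (1 + r))\<^sup>2) * (1 / (1 + r))) *\<^sub>R y"
    by (simp only: klein_def) (simp add: klein_inv_def r_def)
  ultimately show ?thesis by simp
qed

lemma klein_inv_klein:
  assumes "z \<in> unit_disk"
  shows "klein_inv (klein z) = z"
proof -
  define p where "p = (cmod z)\<^sup>2"
  have p: "0 \<le> p" "p < 1"
    using assms by (auto simp: p_def power_less_one_iff)
  have "(cmod (klein z))\<^sup>2 = 4 * p / (1 + p)\<^sup>2"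
    using p by (simp add: klein_def p_def power_mult_distrib power_divide)
  \<comment> \<open>A perfect square, because (1 + p)^2 - 4 p = (1 - p)^2; \<open>p < 1\<close> then
    fixes the sign of the root.\<close>
  then have "1 - (cmod (klein z))\<^sup>2 = ((1 - p) / (1 + p))\<^sup>2"
    using p by (simp add: power_divide divide_simps) (simp add: power2_eq_square algebra_simps)
  then have "sqrt (1 - (cmod (klein z))\<^sup>2) = (1 - p) / (1 + p)"
    using p by simp
  then have "klein_inv (klein z) = (1 / (1 + (1 - p) / (1 + p)) * (2 / (1 + p))) *\<^sub>R z"
    by (simp add: klein_inv_def) (simp add: klein_def p_def)
  also have "1 / (1 + (1 - p) / (1 + p)) * (2 / (1 + p)) = 1"
    using p by (simp add: divide_simps)
  finally show ?thesis by simp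
qed

lemma inj_on_klein: "inj_on klein unit_disk"
  by (metis inj_on_inverseI klein_inv_klein)

lemma continuous_on_klein: "continuous_on S klein"
  unfolding klein_def [abs_def]
  by (intro continuous_intros) (metis add_pos_nonneg less_irrefl zero_le_power2 zero_less_one)

lemma continuous_on_klein_inv: "continuous_on unit_disk klein_inv"
  unfolding klein_inv_def [abs_def]
  by (intro continuous_intros)
     (metis add_pos_nonneg diff_ge_0_iff_ge less_eq_real_def mem_ball_0 norm_ge_zero
       power_le_one real_sqrt_ge_zero less_irrefl zero_less_one)

section \<open>Geodesics as Euclidean chords\<close>

lemma h_geodesic_klein:
  assumes "h_geodesic L"
  obtains n b where "n \<noteq> 0" "\<And>z. z \<in> L \<Longrightarrow> n \<bullet> klein z = b"
proof -
  from assms consider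
    (circle) a r where "r > 0" "(cmod a)\<^sup>2 = 1 + r\<^sup>2" "L = sphere a r \<inter> unit_disk"
    | (line) w where "w \<noteq> 0" "L = range (\<lambda>t::real. t *\<^sub>R w) \<inter> unit_disk"
    unfolding h_geodesic_def by blast
  then show thesis
  proof cases
    case circle
    \<comment> \<open>Orthogonality |a|^2 = 1 + r^2 removes r from the circle equation, leaving 2 (a
      \<bullet> z) = 1 + |z|^2: the polar line of \<open>a\<close>.\<close>
    have "a \<bullet> klein z = 1" if "z \<in> L" for z
    proof -
      have "(dist a z)\<^sup>2 = r\<^sup>2" using that circle by simp
      then have "(a - z) \<bullet> (a - z) = r\<^sup>2"
        by (simp add: dist_norm power2_norm_eq_inner)
      then have "2 * (a \<bullet> z) = 1 + (cmod z)\<^sup>2"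
        using circle(2) by (simp add: power2_norm_eq_inner inner_diff inner_commute)
      moreover have "1 + (cmod z)\<^sup>2 > 0" by (simp add: add_pos_nonneg)
      ultimately show ?thesis by (simp add: klein_def)
    qed
    moreover have "a \<noteq> 0" using circle(2) add_pos_nonneg[of 1 "r\<^sup>2"] by auto
    ultimately show thesis using that by blast
  next
    case line
    \<comment> \<open>Multiplication by the imaginary unit turns the direction of the diameter into
      a normal.\<close>
    have "(\<i> * w) \<bullet> klein z = 0" if "z \<in> L" for z
      using that line by (auto simp: klein_def inner_complex_def)
    then show thesis using that[of "\<i> * w" 0] line by auto
  qed
qed

text \<open>The equations of the previous lemma are read backwards: \<open>b = 0\<close> gives a
  diameter, any other \<open>b\<close> a circle centred at n / b. The point \<open>z0\<close>
  ensures that the line meets the disk.\<close>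

lemma klein_line_h_geodesic:
  assumes "n \<noteq> 0" "z0 \<in> unit_disk" "n \<bullet> klein z0 = b"
  shows "h_geodesic {z \<in> unit_disk. n \<bullet> klein z = b}"
proof (cases "b = 0")
  case True
  have *: "n \<bullet> klein z = 0 \<longleftrightarrow> n \<bullet> z = 0" for z
    by (simp add: klein_def add_nonneg_eq_0_iff)
  have "z \<in> range (\<lambda>t::real. t *\<^sub>R (\<i> * n))" if "n \<bullet> z = 0" for z
  proof -
    \<comment> \<open>Orthogonal expansion of \<open>z\<close> along \<open>n\<close> and its
      quarter turn; the \<open>n\<close> component vanishes.\<close>
    have "z = (((\<i> * n) \<bullet> z) / (cmod n)\<^sup>2) *\<^sub>R (\<i> * n)"
    proof -
      have "(cmod n)\<^sup>2 \<noteq> 0" using assms(1) by simp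
      moreover have "(cmod n)\<^sup>2 *\<^sub>R z = ((\<i> * n) \<bullet> z) *\<^sub>R (\<i> * n)"
        using that unfolding complex_eq_iff cmod_power2 inner_complex_def
        by (simp add: power2_eq_square) algebra
      ultimately show ?thesis
        by (metis (no_types, lifting) divide_inverse_commute left_inverse scaleR_one scaleR_scaleR)
    qed
    then show ?thesis by blast
  qed
  moreover have "n \<bullet> (t *\<^sub>R (\<i> * n)) = 0" for t
    by (simp add: inner_complex_def)
  ultimately have "{z \<in> unit_disk. n \<bullet> klein z = b} = range (\<lambda>t::real. t *\<^sub>R (\<i> * n)) \<inter> unit_disk"
    unfolding True * by auto
  moreover have "\<i> * n \<noteq> 0" using assms(1) by simp
  ultimately show ?thesis unfolding h_geodesic_def by blast
next
  case False
  define a where "a = n /\<^sub>R b"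
  have a: "a \<bullet> klein z = 1 \<longleftrightarrow> n \<bullet> klein z = b" for z
    using False by (auto simp: a_def divide_simps)
  \<comment> \<open>Cauchy-Schwarz at a point inside the disk forces |a| > 1, so the orthogonal
    circle has a positive radius.\<close>
  have "1 = a \<bullet> klein z0" using a assms(3) by simp
  also have "\<dots> \<le> cmod a * cmod (klein z0)" by (rule norm_cauchy_schwarz)
  also have "\<dots> < cmod a"
    using klein_in_disk[OF assms(2)] assms(1) False by (simp add: a_def)
  finally have "1 < cmod a" .
  define r where "r = sqrt ((cmod a)\<^sup>2 - 1)"
  have r: "r > 0" "(cmod a)\<^sup>2 = 1 + r\<^sup>2"
    using \<open>1 < cmod a\<close> by (auto simp: r_def power_gt1 less_imp_le)
  have "z \<in> sphere a r \<longleftrightarrow> a \<bullet> klein z = 1" for z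
  proof -
    have "z \<in> sphere a r \<longleftrightarrow> (dist a z)\<^sup>2 = r\<^sup>2"
      using r(1) by (simp add: power2_eq_iff_nonneg)
    also have "\<dots> \<longleftrightarrow> 2 * (a \<bullet> z) = 1 + (cmod z)\<^sup>2"
      using r(2) by (auto simp: dist_norm power2_norm_eq_inner inner_diff inner_commute)
    also have "\<dots> \<longleftrightarrow> a \<bullet> klein z = 1"
      using add_pos_nonneg[of 1 "(cmod z)\<^sup>2"] by (auto simp: klein_def field_simps)
    finally show ?thesis .
  qed
  then have "{z \<in> unit_disk. n \<bullet> klein z = b} = sphere a r \<inter> unit_disk"
    using a by blast
  then show ?thesis using r unfolding h_geodesic_def by blast
qed

text \<open>The coordinate along the line is continuous and injective on the unit interval, hence
  strictly monotone, so it never leaves the range between its end values.\<close>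

lemma arc_in_line_subset_closed_segment:
  fixes g :: "real \<Rightarrow> complex"
  assumes "arc g" "n \<noteq> 0" "\<And>y. y \<in> path_image g \<Longrightarrow> n \<bullet> y = b"
  shows "path_image g \<subseteq> closed_segment (pathstart g) (pathfinish g)"
proof
  fix y
  assume "y \<in> path_image g"
  then obtain x where x: "x \<in> {0..1}" "y = g x" by (auto simp: path_image_def)
  define f where "f = (\<lambda>t. (\<i> * n) \<bullet> g t)"
  \<comment> \<open>The two inner products with p - q are the real and imaginary parts of cnj n * (p
    - q).\<close>
  have eqI: "p = q" if "n \<bullet> p = n \<bullet> q" "(\<i> * n) \<bullet> p = (\<i> * n) \<bullet> q" for p q
  proof -
    define z where "z = p - q"
    have "n \<bullet> z = 0" "(\<i> * n) \<bullet> z = 0"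
      using that by (simp_all add: z_def inner_diff_right)
    then have "cnj n * z = 0"
      by (simp add: complex_eq_iff inner_complex_def algebra_simps)
    then show ?thesis using assms(2) by (simp add: z_def)
  qed
  have g: "n \<bullet> g t = b" if "t \<in> {0..1}" for t
    using assms(3) that by (auto simp: path_image_def)
  have cont: "continuous_on {0..1} f"
    unfolding f_def using assms(1) by (intro continuous_intros) (simp add: arc_def path_def)
  have inj: "inj_on f {0..1}"
    using assms(1) g eqI unfolding f_def arc_def inj_on_def by metis
  have "f x \<in> closed_segment (f 0) (f 1)"
  proof (cases "x = 0 \<or> x = 1")
    case False
    then have "0 < x" "x < 1" using x by auto
    from continuous_inj_imp_mono[OF this cont inj] show ?thesis
      by (auto simp: closed_segment_eq_real_ivl)
  qed auto
  then obtain u where u: "0 \<le> u" "u \<le> 1" "f x = (1 - u) * f 0 + u * f 1"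
    by (auto simp: in_segment)
  have "g x = (1 - u) *\<^sub>R g 0 + u *\<^sub>R g 1"
  proof (rule eqI)
    show "n \<bullet> g x = n \<bullet> ((1 - u) *\<^sub>R g 0 + u *\<^sub>R g 1)"
      using g x by (simp add: inner_add_right algebra_simps)
    show "(\<i> * n) \<bullet> g x = (\<i> * n) \<bullet> ((1 - u) *\<^sub>R g 0 + u *\<^sub>R g 1)"
      using u(3) by (simp only: f_def inner_add_right inner_scaleR_right)
  qed
  then show "y \<in> closed_segment (pathstart g) (pathfinish g)"
    using u x by (auto simp: in_segment pathstart_def pathfinish_def)
qed

section \<open>Segments and convexity in the Klein model\<close>

lemma h_geodesic_subset_disk: "h_geodesic L \<Longrightarrow> L \<subseteq> unit_disk"
  by (auto simp: h_geodesic_def)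

text \<open>An arc in a geodesic maps to an arc in a line, which is confined to the chord.
  Conversely, \<open>klein_inv\<close> pulls the straight path back to an admissible arc.\<close>

lemma h_segment_klein:
  assumes "u \<in> unit_disk" "v \<in> unit_disk" "u \<noteq> v"
  shows "h_segment u v = {z \<in> unit_disk. klein z \<in> closed_segment (klein u) (klein v)}"
proof (intro equalityI subsetI)
  fix z
  assume "z \<in> h_segment u v"
  then obtain g L where g: "z \<in> path_image g" "arc g" "pathstart g = u" "pathfinish g = v"
    "h_geodesic L" "path_image g \<subseteq> L"
    unfolding h_segment_def by blast
  have disk: "path_image g \<subseteq> unit_disk"
    using g h_geodesic_subset_disk by blast
  obtain n b where n: "n \<noteq> 0" "\<And>z. z \<in> L \<Longrightarrow> n \<bullet> klein z = b"
    using h_geodesic_klein[OF g(5)] by blast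
  have "arc (klein \<circ> g)"
    unfolding arc_def
  proof
    show "path (klein \<circ> g)"
      using g(2) by (intro path_continuous_image continuous_on_klein arc_imp_path)
    show "inj_on (klein \<circ> g) {0..1}"
      using g(2) disk inj_on_subset[OF inj_on_klein]
      by (intro comp_inj_on) (auto simp: arc_def path_image_def)
  qed
  then have "path_image (klein \<circ> g) \<subseteq> closed_segment (klein u) (klein v)"
    using arc_in_line_subset_closed_segment[of "klein \<circ> g" n b] n g
    by (auto simp: path_image_compose pathstart_compose pathfinish_compose)
  then show "z \<in> {z \<in> unit_disk. klein z \<in> closed_segment (klein u) (klein v)}"
    using g(1) disk by (auto simp: path_image_compose)
next
  fix z
  assume z: "z \<in> {z \<in> unit_disk. klein z \<in> closed_segment (klein u) (klein v)}"
  define g where "g = klein_inv \<circ> linepath (klein u) (klein v)"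
  have ne: "klein u \<noteq> klein v"
    using assms inj_on_klein by (meson inj_onD)
  have seg: "closed_segment (klein u) (klein v) \<subseteq> unit_disk"
    using assms by (intro closed_segment_subset klein_in_disk) auto
  \<comment> \<open>A normal to the chord: its direction turned by a right angle.\<close>
  define n where "n = \<i> * (klein v - klein u)"
  let ?L = "{z \<in> unit_disk. n \<bullet> klein z = n \<bullet> klein u}"
  have "h_geodesic ?L"
    using ne by (intro klein_line_h_geodesic[OF _ assms(1)]) (auto simp: n_def)
  moreover have "path_image g \<subseteq> ?L"
  proof
    fix w
    assume "w \<in> path_image g"
    then obtain y where y: "y \<in> closed_segment (klein u) (klein v)" "w = klein_inv y"
      by (auto simp: g_def path_image_compose)
    then have w: "klein w = y" "w \<in> unit_disk"
      using seg klein_klein_inv klein_inv_in_disk by blast+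
    from y(1) obtain t where "y = (1 - t) *\<^sub>R klein u + t *\<^sub>R klein v"
      by (auto simp: in_segment)
    then have "n \<bullet> y = (1 - t) * (n \<bullet> klein u) + t * (n \<bullet> klein v)"
      by (simp only: inner_add_right inner_scaleR_right)
    moreover have "n \<bullet> klein v = n \<bullet> klein u"
      by (simp add: n_def inner_complex_def algebra_simps)
    ultimately have "n \<bullet> y = n \<bullet> klein u"
      by (simp add: algebra_simps)
    with w show "w \<in> ?L" by simp
  qed
  moreover have "arc g"
    unfolding arc_def g_def
  proof
    show "path (klein_inv \<circ> linepath (klein u) (klein v))"
      using seg by (intro path_continuous_image continuous_on_subset[OF continuous_on_klein_inv]) auto
    have "inj_on klein_inv unit_disk"
      by (metis inj_on_inverseI klein_klein_inv)
    then show "inj_on (klein_inv \<circ> linepath (klein u) (klein v)) {0..1}"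
      using arc_linepath[OF ne] seg
      by (intro comp_inj_on) (auto simp: arc_def linepath_image_01 elim: inj_on_subset)
  qed
  moreover have "pathstart g = u" "pathfinish g = v"
    using assms by (auto simp: g_def pathstart_compose pathfinish_compose klein_inv_klein)
  moreover have "z \<in> path_image g"
    using z klein_inv_klein[of z]
    by (auto simp: g_def path_image_compose intro!: image_eqI[of _ _ "klein z"])
  ultimately show "z \<in> h_segment u v"
    unfolding h_segment_def by blast
qed

text \<open>Injectivity of \<open>klein\<close> on the disk lets inclusions of segments be tested on
  images. Equal endpoints give a one-point chord, so they impose no condition on either
  side.\<close>

lemma h_convex_iff_convex_klein:
  "h_convex C \<longleftrightarrow> C \<subseteq> unit_disk \<and> convex (klein ` C)"
proof (cases "C \<subseteq> unit_disk")
  case C: True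
  have "(\<forall>u\<in>C. \<forall>v\<in>C. u \<noteq> v \<longrightarrow> h_segment u v \<subseteq> C) \<longleftrightarrow>
      (\<forall>u\<in>C. \<forall>v\<in>C. closed_segment (klein u) (klein v) \<subseteq> klein ` C)"
  proof (intro ball_cong refl)
    fix u v
    assume uv: "u \<in> C" "v \<in> C"
    show "(u \<noteq> v \<longrightarrow> h_segment u v \<subseteq> C) \<longleftrightarrow> closed_segment (klein u) (klein v) \<subseteq> klein ` C"
    proof (cases "u = v")
      case False
      have disk: "u \<in> unit_disk" "v \<in> unit_disk"
        using uv C by auto
      have "closed_segment (klein u) (klein v) \<subseteq> unit_disk"
        using disk by (intro closed_segment_subset klein_in_disk) auto
      then have "klein ` h_segment u v = closed_segment (klein u) (klein v)"
        unfolding h_segment_klein[OF disk False]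
        using klein_klein_inv klein_inv_in_disk by (force simp del: mem_ball_0)
      moreover have "klein ` h_segment u v \<subseteq> klein ` C \<longleftrightarrow> h_segment u v \<subseteq> C"
        using C by (intro inj_on_image_subset_iff[OF inj_on_klein]) (auto simp: h_segment_klein[OF disk False])
      ultimately show ?thesis using False by simp
    qed (use uv in auto)
  qed
  then show ?thesis
    using C by (simp add: h_convex_def convex_contains_segment)
qed (simp add: h_convex_def)

lemma h_convex_h_dilation0:
  assumes "h_convex C" "0 \<in> C" "k \<ge> 1"
  shows "h_convex (h_dilation0 k ` C)"
proof -
  have C: "C \<subseteq> unit_disk" and conv: "convex (klein ` C)"
    using assms(1) by (auto simp: h_convex_iff_convex_klein)
  have "klein (h_dilation0 k z) = h_dilation0 k (klein z)" if "z \<in> C" for z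
  proof -
    have "z \<in> unit_disk" using that C by blast
    then show ?thesis
      using assms(3) h_dilation0_in_disk[of z k]
      by (simp add: klein_eq_h_dilation0 h_dilation0_mult mult.commute del: mem_ball_0)
  qed
  then have "klein ` h_dilation0 k ` C = h_dilation0 k ` klein ` C"
    by (auto simp: image_image)
  moreover have "convex (h_dilation0 k ` klein ` C)"
  proof (rule convex_h_dilation0)
    show "klein ` C \<subseteq> unit_disk"
      using C klein_in_disk by blast
    show "0 \<in> klein ` C"
      using assms(2) by (auto simp: klein_def intro!: image_eqI[of _ _ 0])
  qed (use conv assms in auto)
  moreover have "h_dilation0 k ` C \<subseteq> unit_disk"
  proof
    fix y assume "y \<in> h_dilation0 k ` C"
    then obtain z where "z \<in> C" "y = h_dilation0 k z" by blast
    then show "y \<in> unit_disk" using C assms(3) h_dilation0_in_disk[of z k] by auto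
  qed
  ultimately show ?thesis by (simp add: h_convex_iff_convex_klein)
qed

subsection \<open>Translations in the Klein model\<close>

text \<open>An affine map divided by a positive affine functional sends segments to segments, with
  the weights reparametrized.\<close>

lemma convex_projective_image:
  fixes A :: "'a::real_vector \<Rightarrow> 'b::real_vector" and l :: "'a \<Rightarrow> real"
  assumes K: "convex K" and pos: "\<And>x. x \<in> K \<Longrightarrow> l x > 0"
    and A: "\<And>x y a b. a + b = 1 \<Longrightarrow> A (a *\<^sub>R x + b *\<^sub>R y) = a *\<^sub>R A x + b *\<^sub>R A y"
    and l: "\<And>x y a b. a + b = 1 \<Longrightarrow> l (a *\<^sub>R x + b *\<^sub>R y) = a * l x + b * l y"
  shows "convex ((\<lambda>x. A x /\<^sub>R l x) ` K)"
proof (rule convexI, elim imageE, hypsubst)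
  fix x y and a b :: real
  assume xy: "x \<in> K" "y \<in> K" and ab: "0 \<le> a" "0 \<le> b" "a + b = 1"
  \<comment> \<open>Weights proportional to a / l x and b / l y cancel the denominators;
    \<open>d\<close> normalizes their sum to 1.\<close>
  define d where "d = a / l x + b / l y"
  define \<alpha> where "\<alpha> = a / l x / d"
  define \<beta> where "\<beta> = b / l y / d"
  have lp: "l x > 0" "l y > 0" using pos xy by auto
  have "d > 0"
    using ab lp by (cases "a = 0") (auto simp: d_def intro!: add_pos_nonneg)
  have sum: "\<alpha> + \<beta> = 1"
    unfolding \<alpha>_def \<beta>_def add_divide_distrib[symmetric] d_def[symmetric]
    using \<open>d > 0\<close> by simp
  have "\<alpha> *\<^sub>R x + \<beta> *\<^sub>R y \<in> K"
    using xy sum ab lp \<open>d > 0\<close> by (intro convexD[OF K]) (auto simp: \<alpha>_def \<beta>_def)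
  moreover have scale: "d * \<alpha> = a / l x" "d * \<beta> = b / l y"
    using \<open>d > 0\<close> by (simp_all add: \<alpha>_def \<beta>_def)
  have "l (\<alpha> *\<^sub>R x + \<beta> *\<^sub>R y) = 1 / d"
    using lp ab by (simp add: l[OF sum]) (simp add: \<alpha>_def \<beta>_def add_divide_distrib[symmetric])
  then have "A (\<alpha> *\<^sub>R x + \<beta> *\<^sub>R y) /\<^sub>R l (\<alpha> *\<^sub>R x + \<beta> *\<^sub>R y)
      = a *\<^sub>R (A x /\<^sub>R l x) + b *\<^sub>R (A y /\<^sub>R l y)"
    using \<open>d > 0\<close> by (simp add: A[OF sum] scaleR_add_right scale divide_inverse)
  ultimately show "a *\<^sub>R (A x /\<^sub>R l x) + b *\<^sub>R (A y /\<^sub>R l y) \<in> (\<lambda>x. A x /\<^sub>R l x) ` K"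
    by (metis (no_types, lifting) image_eqI)
qed

section \<open>Translations as automorphisms of the disk\<close>

lemma one_plus_cnj_mult_neq_0:
  assumes "c \<in> unit_disk" "z \<in> unit_disk"
  shows "1 + cnj c * z \<noteq> 0"
proof
  assume "1 + cnj c * z = 0"
  then have "cmod (cnj c * z) = 1"
    by (metis add_eq_0_iff norm_minus_cancel norm_one)
  moreover have "cmod c * cmod z < 1 * 1"
    using assms by (intro mult_strict_mono') auto
  ultimately show False by (simp add: norm_mult)
qed

lemma h_translation_in_disk:
  assumes "c \<in> unit_disk" "z \<in> unit_disk"
  shows "h_translation c z \<in> unit_disk"
proof -
  have "(cmod (1 + cnj c * z))\<^sup>2 - (cmod (z + c))\<^sup>2 = (1 - (cmod c)\<^sup>2) * (1 - (cmod z)\<^sup>2)"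
    unfolding cmod_power2 by (simp add: algebra_simps power2_eq_square)
  moreover have "(1 - (cmod c)\<^sup>2) * (1 - (cmod z)\<^sup>2) > 0"
    using assms by (simp add: power_less_one_iff)
  ultimately have "(cmod (z + c))\<^sup>2 < (cmod (1 + cnj c * z))\<^sup>2" by linarith
  then have "cmod (z + c) < cmod (1 + cnj c * z)"
    by (rule power_less_imp_less_base) simp
  then show ?thesis
    using one_plus_cnj_mult_neq_0[OF assms] by (simp add: h_translation_def norm_divide)
qed

lemma h_translation_uminus:
  assumes "c \<in> unit_disk" "z \<in> unit_disk"
  shows "h_translation (- c) (h_translation c z) = z"
proof -
  define N where "N = 1 + cnj c * z"
  have N: "N \<noteq> 0" using one_plus_cnj_mult_neq_0[OF assms] by (simp add: N_def)
  \<comment> \<open>The translation denominator at \<open>- c\<close> is 1 - |c|^2, the common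
    factor that cancels at the end.\<close>
  have "1 + cnj c * (- c) \<noteq> 0"
    using one_plus_cnj_mult_neq_0[of c "- c"] assms by simp
  then have nz: "1 - cnj c * c \<noteq> 0" by simp
  have "(z + c) / N - c = z * (1 - cnj c * c) / N"
    using N by (simp add: divide_simps) (simp add: N_def algebra_simps)
  moreover have "1 - cnj c * ((z + c) / N) = (1 - cnj c * c) / N"
    using N by (simp add: divide_simps) (simp add: N_def algebra_simps)
  ultimately show ?thesis
    using N nz by (simp add: h_translation_def N_def[symmetric])
qed

lemma inv_into_h_translation:
  assumes "c \<in> unit_disk" "z \<in> unit_disk"
  shows "inv_into unit_disk (h_translation c) z = h_translation (- c) z"
proof (rule inv_into_f_eq)
  show "inj_on (h_translation c) unit_disk"
    using assms(1) by (metis inj_on_inverseI h_translation_uminus)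
  show "h_translation (- c) z \<in> unit_disk"
    using h_translation_in_disk[of "- c" z] assms by simp
  show "h_translation c (h_translation (- c) z) = z"
    using h_translation_uminus[of "- c" z] assms by simp
qed

text \<open>In Klein coordinates a translation is a quotient of real-affine maps, the form that
  \<open>convex_projective_image\<close> requires.\<close>

lemma klein_h_translation:
  assumes "c \<in> unit_disk" "z \<in> unit_disk"
  defines "y \<equiv> klein z"
  shows "klein (h_translation c z) =
    (y + c\<^sup>2 * cnj y + 2 * c) /\<^sub>R (1 + (cmod c)\<^sup>2 + 2 * Re (cnj c * y))"
proof -
  have klein: "klein w = 2 * w / (1 + w * cnj w)" for w
  proof -
    have "1 + w * cnj w = of_real (1 + (cmod w)\<^sup>2)"
      by (simp only: of_real_add of_real_1 complex_norm_square)
    then show ?thesis by (simp add: klein_def scaleR_conv_of_real)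
  qed
  define N where "N = 1 + cnj c * z"
  define q where "q = 1 + z * cnj z"
  \<comment> \<open>This is |1 + cnj c z|^2 + |z + c|^2. Both it and the numerator contain the
    factor \<open>q\<close>, which cancels once everything is written in \<open>y\<close>.\<close>
  define D where "D = (1 + c * cnj c) * q + 2 * (cnj c * z + c * cnj z)"
  have N: "N \<noteq> 0" "cnj N \<noteq> 0"
    using one_plus_cnj_mult_neq_0[OF assms(1,2)]
    by (simp_all add: N_def del: complex_cnj_add complex_cnj_mult)
  have "q = of_real (1 + (cmod z)\<^sup>2)"
    by (simp only: q_def of_real_add of_real_1 complex_norm_square)
  then have q: "q \<noteq> 0" "cnj q = q"
    by (metis add_pos_nonneg less_irrefl of_real_eq_0_iff zero_le_power2 zero_less_one, simp)
  have y: "y = 2 * z / q" by (simp add: y_def klein q_def)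
  have "klein (h_translation c z) = 2 * (z + c) / N / (1 + (z + c) * cnj (z + c) / (N * cnj N))"
    by (simp add: klein h_translation_def N_def)
  also have "\<dots> = 2 * (z + c) * cnj N / (N * cnj N + (z + c) * cnj (z + c))"
    using N by (simp add: divide_simps) 
  also have "N * cnj N + (z + c) * cnj (z + c) = D"
    by (simp add: N_def D_def q_def algebra_simps)
  also have "2 * (z + c) * cnj N = 2 * z + 2 * c\<^sup>2 * cnj z + 2 * c * q"
    by (simp add: N_def q_def algebra_simps power2_eq_square)
  also have "\<dots> = q * (y + c\<^sup>2 * cnj y + 2 * c)"
    using q by (simp add: y algebra_simps)
  also have "D = q * (1 + c * cnj c + (cnj c * y + c * cnj y))"
    using q by (simp add: D_def y algebra_simps)
  also have "q * (y + c\<^sup>2 * cnj y + 2 * c) / (q * (1 + c * cnj c + (cnj c * y + c * cnj y)))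
      = (y + c\<^sup>2 * cnj y + 2 * c) / (1 + c * cnj c + (cnj c * y + c * cnj y))"
    using q by simp
  also have "1 + c * cnj c + (cnj c * y + c * cnj y) =
      of_real (1 + (cmod c)\<^sup>2 + 2 * Re (cnj c * y))"
  proof -
    have "(cmod c)\<^sup>2 = Re c * Re c + Im c * Im c"
      unfolding cmod_power2 by (simp add: power2_eq_square)
    then show ?thesis by (simp add: complex_eq_iff)
  qed
  finally show ?thesis
    by (simp add: scaleR_conv_of_real divide_inverse mult.commute)
qed

lemma h_convex_h_translation:
  assumes "h_convex C" "c \<in> unit_disk"
  shows "h_convex (h_translation c ` C)"
proof -
  have C: "C \<subseteq> unit_disk" and conv: "convex (klein ` C)"
    using assms(1) by (auto simp: h_convex_iff_convex_klein)
  define P where "P = (\<lambda>y. (y + c\<^sup>2 * cnj y + 2 * c) /\<^sub>R (1 + (cmod c)\<^sup>2 + 2 * Re (cnj c * y)))"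
  have "klein ` h_translation c ` C = P ` klein ` C"
    using C assms(2) by (auto simp: image_image P_def klein_h_translation subset_iff simp del: mem_ball_0
        intro!: image_cong)
  moreover have "convex (P ` klein ` C)"
    unfolding P_def
  proof (rule convex_projective_image[OF conv])
    fix y
    assume "y \<in> klein ` C"
    then have "cmod y < 1"
      using C klein_in_disk by fastforce
    \<comment> \<open>The denominator is bounded below by (1 - |c|)^2, which is positive.\<close>
    have "- Re (cnj c * y) \<le> cmod c * cmod y"
      using abs_Re_le_cmod[of "cnj c * y"] by (simp add: norm_mult del: complex_cnj_mult)
    also have "\<dots> \<le> cmod c"
      using \<open>cmod y < 1\<close> by (simp add: mult_left_le)
    finally have "(1 - cmod c)\<^sup>2 \<le> 1 + (cmod c)\<^sup>2 + 2 * Re (cnj c * y)"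
      by (simp add: power2_diff)
    moreover have "(1 - cmod c)\<^sup>2 > 0" using assms(2) by simp
    ultimately show "0 < 1 + (cmod c)\<^sup>2 + 2 * Re (cnj c * y)" by linarith
  next
    fix x y :: complex and a b :: real
    assume "a + b = 1"
    then have a: "a = 1 - b" by simp
    show "a *\<^sub>R x + b *\<^sub>R y + c\<^sup>2 * cnj (a *\<^sub>R x + b *\<^sub>R y) + 2 * c
        = a *\<^sub>R (x + c\<^sup>2 * cnj x + 2 * c) + b *\<^sub>R (y + c\<^sup>2 * cnj y + 2 * c)"
      by (simp add: a scaleR_conv_of_real algebra_simps)
    show "1 + (cmod c)\<^sup>2 + 2 * Re (cnj c * (a *\<^sub>R x + b *\<^sub>R y))
        = a * (1 + (cmod c)\<^sup>2 + 2 * Re (cnj c * x)) + b * (1 + (cmod c)\<^sup>2 + 2 * Re (cnj c * y))"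
      by (simp add: a algebra_simps)
  qed
  moreover have "h_translation c ` C \<subseteq> unit_disk"
    using C h_translation_in_disk[OF assms(2)] by blast
  ultimately show ?thesis by (simp add: h_convex_iff_convex_klein)
qed

section \<open>Conjugation to the origin\<close>

theorem theorem1:
  fixes C :: "complex set" and c :: complex and k :: real
  assumes "h_convex C" and "c \<in> C" and "k \<ge> 1"
  shows "h_convex (h_dilation c k ` C)"
proof -
  have C: "C \<subseteq> unit_disk" and c: "c \<in> unit_disk"
    using assms by (auto simp: h_convex_def)
  \<comment> \<open>Translating by \<open>- c\<close> moves the centre \<open>c\<close> to 0, where
    the result on central dilations applies.\<close>
  define D where "D = h_translation (- c) ` C"
  have "h_convex D"
    using c unfolding D_def by (intro h_convex_h_translation assms(1)) simp
  moreover have "0 \<in> D"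
    using assms(2) unfolding D_def by (rule rev_image_eqI) (simp add: h_translation_def)
  ultimately have "h_convex (h_translation c ` h_dilation0 k ` D)"
    using assms(3) c by (intro h_convex_h_translation h_convex_h_dilation0)
  moreover have "h_dilation c k ` C = h_translation c ` h_dilation0 k ` D"
    using C inv_into_h_translation[OF c]
    by (auto simp: h_dilation_def D_def image_image subset_iff simp del: mem_ball_0 intro!: image_cong)
  ultimately show ?thesis by simp
qed

end
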